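(* Let $T=1$ and $N\in\mathbb{N}$ (with $N\ge 1$). Suppose $\tilde\mu\in\left(-\cot^2\frac{\pi}{2(N+1)},\,1\right)$. Then there exist real numbers $a_1,\ldots,a_N$ satisfying $a_1+\cdots+a_N=1$ such that, for every $\mu\in(\tilde\mu,1)$, all the roots of the polynomial $p(\lambda)=\lambda^{(N-1)T+1}-\mu\,(q(\lambda))^T$, where $q(\lambda)=a_1\lambda^{N-1}+\cdots+a_{N-1}\lambda+a_N$, lie in the unit disc $\{z\in\mathbb{C}:|z|<1\}$.
   Context: For $T,N\in\mathbb{N}$, real $a_1,\ldots,a_N$ with $a_1+\cdots+a_N=1$, and real $\mu$, define $q(\lambda)=a_1\lambda^{N-1}+\cdots+a_{N-1}\lambda+a_N$ and $p(\lambda)=\lambda^{(N-1)T+1}-\mu\,(q(\lambda))^T$. Here $T=1$, so $p(\lambda)=\lambda^{N}-\mu\,q(\lambda)$. The numbers $a_1,\dots,a_N$ depend only on $\tilde\mu$ and $N$, not on $\mu$. *)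

theory Defs
  imports Complex_Main "HOL-Computational_Algebra.Polynomial"
begin

(* Only the values a 1, ..., a N of the coefficient sequence are used. *)
definition q_poly :: "nat \<Rightarrow> (nat \<Rightarrow> real) \<Rightarrow> real poly" where
  "q_poly N a = (\<Sum>j = 1..N. monom (a j) (N - j))"

definition p_poly :: "nat \<Rightarrow> nat \<Rightarrow> (nat \<Rightarrow> real) \<Rightarrow> real \<Rightarrow> real poly" where
  "p_poly T N a \<mu> = monom 1 ((N - 1) * T + 1) - smult \<mu> (q_poly N a ^ T)"

end

theory Submission
  imports Defs "HOL-Complex_Analysis.Conformal_Mappings"
begin

text \<open>
  Put \<open>F z = a\<^sub>1 z + \<dots> + a\<^sub>N z\<^sup>N\<close>. A root \<open>\<lambda>\<close> of \<open>p\<close> with \<open>\<bar>\<lambda>\<bar> \<ge> 1\<close> amounts to a point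
  \<open>1/\<lambda>\<close> of the closed unit disc where \<open>F\<close> takes the value \<open>1/\<mu>\<close>. So the question is which real
  values \<open>F\<close> takes on the disc. We have \<open>F 1 = 1\<close>, and \<open>F (-1)\<close> will be negative. If \<open>F\<close> is real at no point of the unit circle
  other than \<open>1\<close> and \<open>-1\<close>, then by the open mapping theorem all real values on the disc lie between
  \<open>F (-1)\<close> and \<open>F 1\<close> (\<open>real_values_on_disc_le\<close>, \<open>real_values_on_disc_ge\<close>). Roots outside the open
  disc are then impossible for \<open>0 \<le> \<mu> < 1\<close>, and also for \<open>\<mu> < 0\<close> as long as \<open>\<mu> F (-1) < 1\<close>.

  It remains to make \<open>F (-1)\<close> a small negative number while \<open>Im F\<close> keeps a strict sign on the open
  upper half circle. The Fejer coefficients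
  \<open>2 tan (\<tau>/2) (1 - j/(N+1)) sin (j\<tau>)\<close> with \<open>\<tau> = \<pi>/(N+1)\<close> give \<open>F 1 = 1\<close>,
  \<open>F (-1) = -tan\<^sup>2 (\<tau>/2)\<close> and, for \<open>z = e\<^sup>i\<^sup>t\<close>, an imaginary part that is a nonnegative multiple of
  \<open>sin t cos\<^sup>2 ((N+1)t/2) / (cos t - cos \<tau>)\<^sup>2\<close>; all of this is read off from
  \<open>fejer_sum_closed_form\<close>. This imaginary part has the right sign, but for \<open>N \<ge> 3\<close> it has double
  zeros inside the upper half circle, at which \<open>F\<close> can be real and smaller than \<open>F (-1)\<close>. Mixing in a
  small amount \<open>e\<close> of the polynomial \<open>z\<close>, whose imaginary part is \<open>sin t\<close>, removes these zeros and
  changes \<open>F (-1)\<close> to \<open>-((1 - e) tan\<^sup>2 (\<tau>/2) + e)\<close>. Since \<open>\<mu>'\<close> lies strictly above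
  \<open>-cot\<^sup>2 (\<tau>/2)\<close>, there is room for some \<open>e > 0\<close>; this is where the coefficients come to depend
  on \<open>\<mu>'\<close>.
\<close>

section \<open>Real values of an entire function on the unit disc\<close>

text \<open>
  The points of the disc with real values form a compact set, so a largest real value is attained. It
  cannot be attained in the open disc: the image of the open disc is open, hence would contain a
  slightly larger real number.
\<close>
lemma real_values_on_disc_le:
  fixes f :: "complex \<Rightarrow> complex"
  assumes holo: "f holomorphic_on UNIV"
    and circle: "\<And>z. norm z = 1 \<Longrightarrow> f z \<in> \<real> \<Longrightarrow> z = 1 \<or> z = -1"
    and z: "norm z \<le> 1" "f z \<in> \<real>"
  shows "Re (f z) \<le> max (Re (f 1)) (Re (f (-1)))"
proof -
  define K where "K = {z \<in> cball 0 1. f z \<in> \<real>}"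
  have cont: "continuous_on A f" for A
    using holo holomorphic_on_imp_continuous_on continuous_on_subset by blast
  have "closed (cball 0 1 \<inter> f -` \<real>)"
    by (intro continuous_closed_preimage cont closed_complex_Reals closed_cball)
  moreover have "K = cball 0 1 \<inter> (cball 0 1 \<inter> f -` \<real>)"
    by (auto simp: K_def)
  ultimately have "compact K"
    by (simp only: compact_Int_closed[OF compact_cball])
  moreover have "z \<in> K"
    using z by (simp add: K_def)
  moreover have "continuous_on K (\<lambda>u. Re (f u))"
    by (intro continuous_intros cont)
  ultimately obtain m where m: "m \<in> K" and max: "\<And>u. u \<in> K \<Longrightarrow> Re (f u) \<le> Re (f m)"
    using continuous_attains_sup[of K "\<lambda>u. Re (f u)"] by blast
  have "norm m = 1"
  proof (rule ccontr)
    assume "norm m \<noteq> 1"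
    with m have m_ball: "m \<in> ball 0 1"
      by (auto simp: K_def)
    \<comment> \<open>A constant with a real value would be real on the whole circle, for example at \<open>\<i>\<close>.\<close>
    have "\<not> f constant_on UNIV"
    proof
      assume "f constant_on UNIV"
      then have "f \<i> = f z"
        by (auto simp: constant_on_def)
      then show False
        using circle[of \<i>] z(2) by simp (simp add: complex_eq_iff)
    qed
    then have "open (f ` ball 0 1)"
      using open_mapping_thm[OF holo] by auto
    then obtain e where e: "e > 0" "ball (f m) e \<subseteq> f ` ball 0 1"
      using m_ball openE by blast
    have "f m + of_real (e / 2) \<in> ball (f m) e"
      using e(1) by (simp add: dist_norm)
    then obtain u where u: "u \<in> ball 0 1" "f u = f m + of_real (e / 2)"
      using e(2) by (metis (no_types, lifting) imageE subsetD)
    then have "u \<in> K"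
      using m by (simp add: K_def)
    from max[OF this] show False
      using u(2) e(1) by simp
  qed
  with m circle have "m = 1 \<or> m = -1"
    by (auto simp: K_def)
  with max[OF \<open>z \<in> K\<close>] show ?thesis
    by auto
qed

corollary real_values_on_disc_ge:
  fixes f :: "complex \<Rightarrow> complex"
  assumes "f holomorphic_on UNIV"
    and "\<And>z. norm z = 1 \<Longrightarrow> f z \<in> \<real> \<Longrightarrow> z = 1 \<or> z = -1"
    and "norm z \<le> 1" "f z \<in> \<real>"
  shows "min (Re (f 1)) (Re (f (-1))) \<le> Re (f z)"
  using real_values_on_disc_le[of "\<lambda>u. - f u" z] assms
  by (force intro: holomorphic_intros simp: min_def max_def split: if_splits)

section \<open>The Fejer polynomial\<close>

lemma sum_weighted_geometric:
  fixes u :: "'a::comm_ring_1"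
  shows "(1 - u)\<^sup>2 * (\<Sum>j = 1..N. of_nat (N + 1 - j) * u ^ j) =
    of_nat (N + 1) * u * (1 - u) - u * (1 - u ^ (N + 1))"
proof (induction N)
  case 0
  then show ?case by simp
next
  case (Suc N)
  have geo: "(1 - u) * (\<Sum>j = 1..n. u ^ j) = u - u ^ Suc n" for n
  proof (induction n)
    case (Suc n)
    have "(1 - u) * (\<Sum>j = 1..Suc n. u ^ j) = (1 - u) * (\<Sum>j = 1..n. u ^ j) + (1 - u) * u ^ Suc n"
      by (simp add: distrib_left)
    also have "\<dots> = u - u ^ Suc (Suc n)"
      unfolding Suc by (simp add: algebra_simps)
    finally show ?case .
  qed simp
  have "(\<Sum>j = 1..Suc N. of_nat (Suc N + 1 - j) * u ^ j) =
      (\<Sum>j = 1..Suc N. of_nat (N + 1 - j) * u ^ j + u ^ j)"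
    by (intro sum.cong) (auto simp: Suc_diff_le algebra_simps)
  also have "\<dots> = (\<Sum>j = 1..N. of_nat (N + 1 - j) * u ^ j) + (\<Sum>j = 1..Suc N. u ^ j)"
    unfolding sum.distrib by simp
  finally have "(1 - u)\<^sup>2 * (\<Sum>j = 1..Suc N. of_nat (Suc N + 1 - j) * u ^ j) =
      of_nat (N + 1) * u * (1 - u) - u * (1 - u ^ (N + 1))
      + (1 - u) * ((1 - u) * (\<Sum>j = 1..Suc N. u ^ j))"
    unfolding Suc.IH[symmetric] by (simp add: distrib_left power2_eq_square mult.assoc)
  then show ?case
    unfolding geo by (simp add: algebra_simps)
qed

text \<open>
  Without the normalising factor \<open>2 tan (\<tau>/2) / (N+1)\<close> that gives value \<open>1\<close> at \<open>1\<close>.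
\<close>
definition fejer_sum :: "nat \<Rightarrow> complex \<Rightarrow> complex" where
  "fejer_sum N z =
    (\<Sum>j = 1..N. of_real (real (N + 1 - j) * sin (real j * (pi / (real N + 1)))) * z ^ j)"

text \<open>
  With \<open>w = e\<^sup>i\<^sup>\<tau>\<close> and \<open>v = 1/w\<close>, the sum is \<open>1/(2\<i>)\<close> times the difference of the weighted geometric
  sums at \<open>wz\<close> and \<open>vz\<close>. The angle \<open>\<tau> = \<pi>/(N+1)\<close> matters because \<open>w\<^sup>N\<^sup>+\<^sup>1 = v\<^sup>N\<^sup>+\<^sup>1 = -1\<close>, so that
  both sums have the same boundary factor \<open>1 + z\<^sup>N\<^sup>+\<^sup>1\<close>. The denominators combine to
  \<open>(1 - wz)(1 - vz) = D\<close>; they are cleared because \<open>D\<close> vanishes at \<open>w\<close> and \<open>v\<close>.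
\<close>
lemma fejer_sum_closed_form:
  fixes N :: nat and z :: complex
  defines "\<tau> \<equiv> pi / (real N + 1)"
  defines "D \<equiv> 1 - 2 * of_real (cos \<tau>) * z + z\<^sup>2"
  shows "D\<^sup>2 * fejer_sum N z =
    of_real (sin \<tau>) * (of_nat (N + 1) * z * D - (1 + z ^ (N + 1)) * z * (1 - z\<^sup>2))"
proof -
  define w v where "w = cis \<tau>" and "v = cis (- \<tau>)"
  define H where "H u = (\<Sum>j = 1..N. of_nat (N + 1 - j) * u ^ j)" for u :: complex
  have wv: "w * v = 1"
    by (simp add: w_def v_def cis_mult)
  have wv_sum: "w + v = 2 * of_real (cos \<tau>)" and wv_diff: "w - v = 2 * \<i> * of_real (sin \<tau>)"
    by (auto simp: w_def v_def complex_eq_iff)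
  have M\<tau>: "real (N + 1) * \<tau> = pi"
    by (simp add: \<tau>_def add.commute)
  have wM: "w ^ (N + 1) = -1" and vM: "v ^ (N + 1) = -1"
    using M\<tau> unfolding w_def v_def Complex.DeMoivre by (simp_all add: complex_eq_iff)
  have summand: "2 * \<i> * (of_real (real k * sin (real j * \<tau>)) * z ^ j) =
      of_nat k * (w * z) ^ j - of_nat k * (v * z) ^ j" for j k
  proof -
    have "2 * \<i> * of_real (sin (real j * \<tau>)) = w ^ j - v ^ j"
      by (simp add: w_def v_def Complex.DeMoivre complex_eq_iff)
    then have "of_nat k * (2 * \<i> * of_real (sin (real j * \<tau>))) * z ^ j =
        of_nat k * (w ^ j - v ^ j) * z ^ j"
      by (simp only:)
    then show ?thesis
      by (simp add: power_mult_distrib algebra_simps)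
  qed
  have two_i: "2 * \<i> * fejer_sum N z = H (w * z) - H (v * z)"
    unfolding fejer_sum_def H_def \<tau>_def[symmetric] sum_distrib_left sum_subtractf[symmetric]
    by (intro sum.cong refl summand)
  have D: "D = (1 - w * z) * (1 - v * z)"
  proof -
    have "(1 - w * z) * (1 - v * z) = 1 - (w + v) * z + (w * v) * z\<^sup>2"
      by (simp add: algebra_simps power2_eq_square)
    then show ?thesis by (simp add: D_def wv wv_sum)
  qed
  have wzM: "(w * z) ^ (N + 1) = - (z ^ (N + 1))" and vzM: "(v * z) ^ (N + 1) = - (z ^ (N + 1))"
    unfolding power_mult_distrib wM vM by simp_all
  have Hw: "(1 - w * z)\<^sup>2 * H (w * z) = of_nat (N + 1) * (w * z) * (1 - w * z) - w * z * (1 + z ^ (N + 1))"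
    unfolding H_def sum_weighted_geometric wzM by simp
  have Hv: "(1 - v * z)\<^sup>2 * H (v * z) = of_nat (N + 1) * (v * z) * (1 - v * z) - v * z * (1 + z ^ (N + 1))"
    unfolding H_def sum_weighted_geometric vzM by simp
  have alg: "(1 - v * z)\<^sup>2 * (M * (w * z) * (1 - w * z) - w * z * P)
      - (1 - w * z)\<^sup>2 * (M * (v * z) * (1 - v * z) - v * z * P)
      = (w - v) * (M * z * ((1 - w * z) * (1 - v * z)) - P * z * (1 - z\<^sup>2))" for M P
    using wv by algebra
  have "2 * \<i> * (D\<^sup>2 * fejer_sum N z) = D\<^sup>2 * H (w * z) - D\<^sup>2 * H (v * z)"
    unfolding right_diff_distrib[symmetric] two_i[symmetric] by (simp only: mult.left_commute)
  also have "\<dots> = (1 - v * z)\<^sup>2 * ((1 - w * z)\<^sup>2 * H (w * z)) - (1 - w * z)\<^sup>2 * ((1 - v * z)\<^sup>2 * H (v * z))"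
    unfolding D power_mult_distrib by (simp only: mult_ac)
  also have "\<dots> = (w - v) * (of_nat (N + 1) * z * D - (1 + z ^ (N + 1)) * z * (1 - z\<^sup>2))"
    unfolding Hw Hv alg D ..
  also have "\<dots> = 2 * \<i> * (of_real (sin \<tau>) *
      (of_nat (N + 1) * z * D - (1 + z ^ (N + 1)) * z * (1 - z\<^sup>2)))"
    by (simp add: wv_diff)
  finally show ?thesis by simp
qed

lemma
  assumes "N \<ge> 1"
  shows fejer_sum_at_1:
      "2 * of_real (tan (pi / (2 * (real N + 1)))) * fejer_sum N 1 = of_nat (N + 1)"
    and fejer_sum_at_minus_1:
      "2 * fejer_sum N (-1) = - of_real (tan (pi / (2 * (real N + 1)))) * of_nat (N + 1)"
proof -
  define \<sigma> where "\<sigma> = pi / (2 * (real N + 1))"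
  define s c :: complex where "s = of_real (sin \<sigma>)" and "c = of_real (cos \<sigma>)"
  have \<tau>: "pi / (real N + 1) = 2 * \<sigma>"
    by (simp add: \<sigma>_def divide_simps)
  have \<sigma>: "0 < \<sigma>" "\<sigma> < pi / 2"
    using assms by (auto simp: \<sigma>_def field_simps)
  then have "sin \<sigma> > 0" "cos \<sigma> > 0"
    using \<sigma> by (auto intro: sin_gt_zero cos_gt_zero)
  then have nz: "s \<noteq> 0" "c \<noteq> 0"
    by (auto simp: s_def c_def)
  have tan: "of_real (tan \<sigma>) = s / c"
    by (simp add: s_def c_def tan_def)
  have cs: "c\<^sup>2 = 1 - s\<^sup>2"
    by (simp add: s_def c_def cos_squared_eq flip: of_real_power)
  have sin2: "of_real (sin (2 * \<sigma>)) = 2 * s * c"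
    by (simp add: s_def c_def sin_double)
  have cos2: "of_real (cos (2 * \<sigma>)) = c\<^sup>2 - s\<^sup>2"
    by (simp add: s_def c_def cos_double)
  have "(4 * s\<^sup>2)\<^sup>2 * fejer_sum N 1 = 2 * s * c * (of_nat (N + 1) * (4 * s\<^sup>2))"
    using fejer_sum_closed_form[of N 1] unfolding \<tau> sin2 cos2 by (simp add: cs)
  then have "2 * s * fejer_sum N 1 = c * of_nat (N + 1)"
    using nz by (simp add: power2_eq_square mult.assoc)
  then show "2 * of_real (tan (pi / (2 * (real N + 1)))) * fejer_sum N 1 = of_nat (N + 1)"
    using nz unfolding \<sigma>_def[symmetric] tan by (simp add: field_simps)
  have s2: "s\<^sup>2 = 1 - c\<^sup>2"
    by (simp add: cs)
  have "(4 * c\<^sup>2)\<^sup>2 * fejer_sum N (-1) = 2 * s * c * (- of_nat (N + 1) * (4 * c\<^sup>2))"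
    using fejer_sum_closed_form[of N "-1"] unfolding \<tau> sin2 cos2 by (simp add: s2)
  then have "2 * c * fejer_sum N (-1) = - s * of_nat (N + 1)"
    using nz by (simp add: power2_eq_square mult.assoc) (simp add: algebra_simps)
  then show "2 * fejer_sum N (-1) = - of_real (tan (pi / (2 * (real N + 1)))) * of_nat (N + 1)"
    using nz unfolding \<sigma>_def[symmetric] tan by (simp add: field_simps)
qed

text \<open>
  On the unit circle \<open>D = z d\<close> with \<open>d = 2 (Re z - cos \<tau>)\<close> real, and \<open>1 - z\<^sup>2 = -2\<i> z Im z\<close>. After
  division by \<open>z\<^sup>2\<close> the first summand of the closed form is therefore real and drops out of the imaginary
  part, so \<open>d\<^sup>2 Im (fejer_sum N z)\<close> equals \<open>2 sin \<tau> Im z (1 + Re z\<^sup>N\<^sup>+\<^sup>1)\<close>, where the last factor is nonnegative. Multiplying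
  by \<open>Im z\<close> treats both half circles at once.
\<close>
lemma Im_fejer_sum_on_circle:
  assumes "norm z = 1"
  shows "Im z * Im (fejer_sum N z) \<ge> 0"
proof -
  define \<tau> where "\<tau> = pi / (real N + 1)"
  have \<tau>: "0 < \<tau>" "\<tau> \<le> pi"
    by (auto simp: \<tau>_def field_simps)
  have sin_\<tau>: "sin \<tau> \<ge> 0"
    using \<tau> by (intro sin_ge_zero) auto
  define d where "d = 2 * (Re z - cos \<tau>)"
  have unit: "z * cnj z = 1"
    using assms by (simp add: complex_norm_square[symmetric])
  have z: "z \<noteq> 0"
    using assms by auto
  show ?thesis
  proof (cases "d = 0")
    case False
    have D: "1 - 2 * of_real (cos \<tau>) * z + z\<^sup>2 = z * of_real d"
    proof -
      have "of_real d = z + cnj z - 2 * of_real (cos \<tau>)"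
        by (simp add: d_def complex_eq_iff)
      then have "z * of_real d = z\<^sup>2 + z * cnj z - 2 * of_real (cos \<tau>) * z"
        by (simp only:) (simp add: algebra_simps power2_eq_square)
      then show ?thesis
        by (simp add: unit)
    qed
    have one: "1 - z\<^sup>2 = - (2 * \<i> * of_real (Im z) * z)"
    proof -
      have "2 * \<i> * of_real (Im z) = z - cnj z"
        by (simp add: complex_eq_iff)
      then have "2 * \<i> * of_real (Im z) * z = z\<^sup>2 - z * cnj z"
        by (simp only:) (simp add: algebra_simps power2_eq_square)
      then show ?thesis
        by (simp add: unit)
    qed
    have "z\<^sup>2 * (of_real (d\<^sup>2) * fejer_sum N z) =
        z\<^sup>2 * (of_real (sin \<tau>) * (of_real (real (N + 1) * d) + 2 * \<i> * of_real (Im z) * (1 + z ^ (N + 1))))"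
      using fejer_sum_closed_form[of N z] unfolding \<tau>_def[symmetric] D one
      by (simp add: algebra_simps power2_eq_square)
    then have "of_real (d\<^sup>2) * fejer_sum N z =
        of_real (sin \<tau>) * (of_real (real (N + 1) * d) + 2 * \<i> * of_real (Im z) * (1 + z ^ (N + 1)))"
      using z by simp
    from arg_cong[OF this, of Im]
    have "d\<^sup>2 * Im (fejer_sum N z) = sin \<tau> * (2 * Im z * (1 + Re (z ^ (N + 1))))"
      by (simp del: power_Suc of_real_power)
    then have "Im z * (d\<^sup>2 * Im (fejer_sum N z)) = 2 * sin \<tau> * (Im z)\<^sup>2 * (1 + Re (z ^ (N + 1)))"
      by (simp only: power2_eq_square mult_ac)
    then have "d\<^sup>2 * (Im z * Im (fejer_sum N z)) = 2 * sin \<tau> * (Im z)\<^sup>2 * (1 + Re (z ^ (N + 1)))"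
      by (simp only: mult.left_commute)
    moreover have "\<bar>Re (z ^ (N + 1))\<bar> \<le> 1"
      using abs_Re_le_cmod[of "z ^ (N + 1)"] assms by (simp only: norm_power power_one)
    ultimately have "d\<^sup>2 * (Im z * Im (fejer_sum N z)) \<ge> 0"
      using sin_\<tau> by simp
    then show ?thesis
      using False by (simp add: zero_le_mult_iff)
  next
    \<comment> \<open>The closed form says nothing at \<open>z = e\<^sup>\<plusminus>\<^sup>i\<^sup>\<tau>\<close>, but there the sum consists of nonnegative terms.\<close>
    case True
    then have Re: "Re z = cos \<tau>"
      by (simp add: d_def)
    have "(Im z)\<^sup>2 = (sin \<tau>)\<^sup>2"
      using assms Re by (simp add: cmod_def sin_squared_eq)
    then have "Im z = sin \<tau> \<or> Im z = - sin \<tau>"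
      by (simp add: power2_eq_iff)
    then obtain s :: real where s: "s = 1 \<or> s = -1" "z = cis (s * \<tau>)"
      using Re that[of 1] that[of "-1"] by (auto simp: complex_eq_iff)
    have "Im z * Im (fejer_sum N z) =
        (\<Sum>j = 1..N. real (N + 1 - j) * sin \<tau> * (sin (real j * \<tau>))\<^sup>2)"
      using s unfolding fejer_sum_def \<tau>_def[symmetric]
      by (auto simp: Complex.DeMoivre sum_distrib_left power2_eq_square mult_ac sum_negf intro!: sum.cong)
    also have "\<dots> \<ge> 0"
      using sin_\<tau> by (intro sum_nonneg) simp
    finally show ?thesis .
  qed
qed

section \<open>Location of the roots\<close>

lemma root_of_p_poly:
  assumes "poly (map_poly complex_of_real (p_poly 1 N a \<mu>)) z = 0" and "N \<ge> 1" and "z \<noteq> 0"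
  shows "of_real \<mu> * (\<Sum>j = 1..N. of_real (a j) * (1 / z) ^ j) = 1"
proof -
  have "poly (map_poly complex_of_real (p_poly 1 N a \<mu>)) z =
      z ^ N - of_real \<mu> * (\<Sum>j = 1..N. of_real (a j) * z ^ (N - j))"
  proof -
    have hom: "map_poly complex_of_real (p - smult c q) = map_poly complex_of_real p - smult (of_real c) (map_poly complex_of_real q)" for p q c
      by (simp add: poly_eq_iff coeff_map_poly)
    have "map_poly complex_of_real (q_poly N a) = (\<Sum>j = 1..N. monom (of_real (a j)) (N - j))"
      by (simp add: q_poly_def poly_eq_iff coeff_map_poly coeff_sum)
         (intro allI sum.cong; auto)
    then show ?thesis
      using assms(2) by (simp add: p_poly_def hom map_poly_monom poly_monom poly_sum)
  qed
  also have "(\<Sum>j = 1..N. of_real (a j) * z ^ (N - j)) =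
      z ^ N * (\<Sum>j = 1..N. of_real (a j) * (1 / z) ^ j)"
    unfolding sum_distrib_left using assms(3)
    by (intro sum.cong) (auto simp: power_diff power_one_over)
  finally have "z ^ N * (1 - of_real \<mu> * (\<Sum>j = 1..N. of_real (a j) * (1 / z) ^ j)) = 0"
    using assms(1) by (simp add: algebra_simps)
  then show ?thesis
    using assms(3) by simp
qed

text \<open>
  For \<open>s = tan\<^sup>2 (\<tau>/2)\<close> and \<open>m = -\<mu>'\<close>: the strict inequality \<open>\<mu>' > -cot\<^sup>2 (\<tau>/2)\<close> survives a small
  perturbation of the coefficients.
\<close>
lemma exists_perturbation:
  fixes s m :: real
  assumes "0 \<le> s" "m * s < 1"
  obtains e where "0 < e" "e \<le> 1" "m * ((1 - e) * s + e) \<le> 1"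
proof (cases "m \<le> 0")
  case True
  then show ?thesis
    using that[of 1] by simp
next
  case False
  \<comment> \<open>The value at \<open>-1\<close> grows by at most \<open>e\<close> in absolute value, and \<open>1/m - s\<close> is the slack.\<close>
  define e where "e = min 1 (1 / m - s)"
  have "(1 - e) * s + e \<le> s + e"
    using assms False by (simp add: e_def algebra_simps min_def field_simps)
  also have "\<dots> \<le> 1 / m"
    by (simp add: e_def)
  finally have "m * ((1 - e) * s + e) \<le> 1"
    using False by (simp add: field_simps)
  then show ?thesis
    using that[of e] assms False by (simp add: e_def field_simps)
qed

theorem theorem1:
  fixes T N :: nat and \<mu>' :: real
  assumes "T = 1"
    and "N \<ge> 1"
    and "\<mu>' \<in> {- (cot (pi / (2 * (real N + 1))))\<^sup>2 <..< 1}"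
  shows "\<exists>a :: nat \<Rightarrow> real. (\<Sum>j = 1..N. a j) = 1 \<and>
           (\<forall>\<mu> \<in> {\<mu>'<..<1}. \<forall>z :: complex.
              poly (map_poly complex_of_real (p_poly T N a \<mu>)) z = 0 \<longrightarrow> norm z < 1)"
proof -
  define \<sigma> where "\<sigma> = pi / (2 * (real N + 1))"
  define t where "t = tan \<sigma>"
  have \<sigma>: "0 < \<sigma>" "\<sigma> < pi / 2"
    using assms(2) by (auto simp: \<sigma>_def field_simps)
  have t_pos: "t > 0"
    using \<sigma> by (simp add: t_def tan_gt_zero)
  have "-\<mu>' * t\<^sup>2 < 1"
  proof -
    have "-\<mu>' < 1 / t\<^sup>2"
      using assms(3) unfolding \<sigma>_def[symmetric] t_def
      by (simp add: cot_def tan_def power_divide)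
    then show ?thesis
      using t_pos by (simp add: field_simps)
  qed
  then obtain e where e: "0 < e" "e \<le> 1" "-\<mu>' * ((1 - e) * t\<^sup>2 + e) \<le> 1"
    using exists_perturbation[of "t\<^sup>2" "-\<mu>'"] by (metis zero_le_power2)
  define r where "r = (1 - e) * t\<^sup>2 + e"
  have r_pos: "r > 0"
    using e by (simp add: r_def add_nonneg_pos)
  define b where "b = (1 - e) * (2 * t / (real N + 1))"
  define a where "a j = b * (real (N + 1 - j) * sin (real j * (pi / (real N + 1)))) + (if j = 1 then e else 0)"
    for j :: nat
  define F where "F z = (\<Sum>j = 1..N. of_real (a j) * z ^ j)" for z :: complex
  have F: "F z = of_real b * fejer_sum N z + of_real e * z" for z
  proof -
    have "F z = (\<Sum>j = 1..N. of_real b * (of_real (real (N + 1 - j) * sin (real j * (pi / (real N + 1)))) * z ^ j)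
        + (if j = 1 then of_real e * z else 0))"
      unfolding F_def a_def by (intro sum.cong) (auto simp: algebra_simps)
    then show ?thesis
      using assms(2) by (simp add: sum.distrib fejer_sum_def sum_distrib_left)
  qed
  have F_1: "F 1 = 1"
  proof -
    have "of_real b * fejer_sum N 1 =
        of_real ((1 - e) / (real N + 1)) * (2 * of_real t * fejer_sum N 1)"
      by (simp add: b_def)
    also have "\<dots> = of_real ((1 - e) / (real N + 1) * real (N + 1))"
      using fejer_sum_at_1[OF assms(2)] unfolding t_def \<sigma>_def by simp
    also have "(1 - e) / (real N + 1) * real (N + 1) = 1 - e"
      by (simp add: add.commute)
    finally show ?thesis
      by (simp add: F)
  qed
  have F_m1: "F (-1) = of_real (- r)"
  proof -
    have "of_real b * fejer_sum N (-1) =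
        of_real ((1 - e) * t / (real N + 1)) * (2 * fejer_sum N (-1))"
      by (simp add: b_def)
    also have "\<dots> = of_real ((1 - e) * t / (real N + 1) * (- t * real (N + 1)))"
      using fejer_sum_at_minus_1[OF assms(2)] unfolding t_def \<sigma>_def by simp
    also have "(1 - e) * t / (real N + 1) * (- t * real (N + 1)) = - ((1 - e) * t\<^sup>2)"
      by (simp add: field_simps power2_eq_square)
    finally show ?thesis
      by (simp add: F r_def)
  qed
  have holo: "F holomorphic_on UNIV"
    unfolding F_def by (intro holomorphic_intros)
  have circle: "z = 1 \<or> z = -1" if z: "norm z = 1" "F z \<in> \<real>" for z
  proof -
    have "Im (F z) = b * Im (fejer_sum N z) + e * Im z"
      by (simp add: F)
    then have "Im z * (b * Im (fejer_sum N z) + e * Im z) = 0"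
      using z(2) by (simp add: complex_is_Real_iff)
    then have "b * (Im z * Im (fejer_sum N z)) + e * (Im z)\<^sup>2 = 0"
      by (simp add: algebra_simps power2_eq_square)
    moreover have "b * (Im z * Im (fejer_sum N z)) \<ge> 0"
      using Im_fejer_sum_on_circle[OF z(1)] e t_pos by (simp add: b_def)
    ultimately have "Im z = 0"
      using e(1) by (smt (verit) mult_pos_pos zero_less_power2)
    then show ?thesis
      using z(1) by (auto simp: cmod_def complex_eq_iff)
  qed
  have "norm z < 1"
    if \<mu>: "\<mu>' < \<mu>" "\<mu> < 1" and root: "poly (map_poly complex_of_real (p_poly T N a \<mu>)) z = 0"
    for \<mu> :: real and z :: complex
  proof (rule ccontr)
    assume "\<not> norm z < 1"
    then have "z \<noteq> 0" and disc: "norm (1 / z) \<le> 1"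
      by (auto simp: norm_divide divide_le_eq)
    then have "of_real \<mu> * F (1 / z) = 1"
      using root root_of_p_poly[of N a \<mu> z] assms(1,2) by (simp add: F_def)
    then have "\<mu> \<noteq> 0" and val: "F (1 / z) = of_real (1 / \<mu>)"
      by (auto simp: eq_divide_eq mult.commute)
    then have "F (1 / z) \<in> \<real>"
      by simp
    note bounds = real_values_on_disc_le[OF holo circle disc this]
      real_values_on_disc_ge[OF holo circle disc this]
    then have le: "1 / \<mu> \<le> 1" and ge: "- r \<le> 1 / \<mu>"
      using r_pos by (auto simp: val F_1 F_m1)
    \<comment> \<open>A positive \<open>\<mu> < 1\<close> contradicts the upper bound, a negative \<open>\<mu> > \<mu>'\<close> the lower one.\<close>
    show False
    proof (cases "\<mu> > 0")
      case True
      with le \<mu>(2) show False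
        by (simp add: field_simps)
    next
      case False
      with ge \<open>\<mu> \<noteq> 0\<close> have "1 \<le> -\<mu> * r"
        by (simp add: field_simps)
      also have "\<dots> < -\<mu>' * r"
        using \<mu>(1) r_pos by simp
      finally show False
        using e(3) by (simp add: r_def)
    qed
  qed
  moreover have "(\<Sum>j = 1..N. a j) = 1"
    using F_1 by (simp add: F_def flip: of_real_sum)
  ultimately show ?thesis
    by (intro exI[of _ a]) auto
qed

end
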